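(* Let $\Lambda\leq\omega_2$ be a limit ordinal and let $\mathfrak F=(\phi_\eta)_{\eta<\Lambda}$ be a sequence of normal functions of first class satisfying properties (1)–(4) described in the context. If $(\eta'_x)_{x<\Omega}$ is a strictly increasing sequence of ordinals with $\eta'_x<\Lambda$ for all $x<\Omega$, then $\bigcap_{x<\Omega}V\phi_{\eta'_x}=\emptyset$.
   Context: $\Omega=\omega_1$, $\omega_2$ is the second uncountable initial ordinal. A normal function of first class is a strictly increasing function $\phi$ from $\{x:1\leq x<\Omega\}$ to itself which is continuous: $\phi(x)=\sup_{1\leq x'<x}\phi(x')$ for limit $x<\Omega$. $V\phi$ is its range; the derivative $\phi'$ is the normal function of first class enumerating increasingly the fixed points of $\phi$. A limit ordinal $\eta<\omega_2$ is "of the second kind" if it has cofinality $\omega$ and "of the third kind" if it has cofinality $\Omega$. For ordinals $\alpha<\beta<\Lambda$, write $\alpha\to\beta$ if $V\phi_\zeta\subseteq V\phi_\alpha$ for all $\zeta$ with $\alpha<\zeta\leq\beta$. Properties of $\mathfrak F$ (for all $\eta<\Lambda$): (1a) $\phi_0(x)=\omega^x$. (1b) If $\eta=\eta'+1$ then $\phi_\eta=\phi'_{\eta'}$. (1c) If $\eta$ is of the second kind, $\eta$ is assigned a countable limit ordinal $\tau_\eta$ and a strictly increasing sequence $(\eta_x)_{x<\tau_\eta}$ with supremum $\eta$, and $V\phi_\eta=\bigcap_{x<\tau_\eta}V\phi_{\eta_x}$. (1d) If $\eta$ is of the third kind, $\eta$ is assigned a strictly increasing sequence $(\eta_x)_{x<\Omega}$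 with supremum $\eta$ (set $\tau_\eta=\Omega$), and $\phi_\eta(x)=\phi_{\eta_x}(1)$ for $1\leq x<\Omega$. (2) For every limit $\eta<\Lambda$ with assigned sequence $(\eta_x)_{x<\tau_\eta}$ and all $x$ with $1\leq x<\tau_\eta$: (a) if $x$ is a limit ordinal, then the sequence assigned to $\eta_x$ is $(\eta_{x'})_{x'<x}$; (b) $\eta_x+1\to\eta_{x+1}$. (3) If $\eta<\Lambda$ is of the second kind and $\phi_\eta(1)=\tau_\eta$, then there is an ordinal $\tilde\eta$ of the third kind with $\eta<\tilde\eta<\Lambda$ whose assigned sequence $(\tilde\eta_x)_{x<\Omega}$ satisfies $\tilde\eta_x=\eta_x$ for $x<\tau_\eta$ and $\tilde\eta_{\tau_\eta}=\eta$. (4) If $(\eta_\nu)_{\nu<\lambda}$ is a sequence of ordinals $<\Lambda$ whose length $\lambda$ is a limit ordinal and with $\sup_{\nu<\lambda}\eta_\nu=\Lambda$, then $\bigcap_{\nu<\lambda}V\phi_{\eta_\nu}=\emptyset$. *)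

theory Defs
  imports Complex_Main "HOL-Library.Countable_Set_Type"
begin

unbundle cardinal_syntax

section \<open>Ordinals\<close>

text \<open>The ordinals below \<open>\<omega>\<^sub>3\<close>, as the elements of the canonical well-order of that type.
  Every ordinal up to \<open>\<omega>\<^sub>2\<close>, and every supremum of at most \<open>\<aleph>\<^sub>2\<close> many such ordinals, lives here.\<close>

abbreviation omega3_rel :: "nat set set set rel" where
  "omega3_rel \<equiv> cardSuc (cardSuc (cardSuc natLeq))"

lemma Cinfinite_cardSucs:
  "Cinfinite (cardSuc natLeq)" "Cinfinite (cardSuc (cardSuc natLeq))" "Cinfinite omega3_rel"
  by (intro Cinfinite_cardSuc natLeq_Cinfinite)+

lemma Card_order_cardSucs:
  "Card_order (cardSuc natLeq)" "Card_order (cardSuc (cardSuc natLeq))" "Card_order omega3_rel"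
  using Cinfinite_cardSucs by blast+

lemma Well_order_omega3: "Well_order omega3_rel"
  using Card_order_cardSucs(3) card_order_on_well_order_on by blast

typedef ordinal = "Field omega3_rel"
proof -
  have "infinite (Field omega3_rel)"
    using Cinfinite_cardSucs(3) unfolding cinfinite_def by blast
  then show ?thesis by (metis ex_in_conv finite.emptyI)
qed

instantiation ordinal :: linorder
begin

definition less_eq_ordinal :: "ordinal \<Rightarrow> ordinal \<Rightarrow> bool" where
  "a \<le> b \<longleftrightarrow> (Rep_ordinal a, Rep_ordinal b) \<in> omega3_rel"

definition less_ordinal :: "ordinal \<Rightarrow> ordinal \<Rightarrow> bool" where
  "a < b \<longleftrightarrow> a \<le> b \<and> \<not> b \<le> (a::ordinal)"

instance
proof
  have L: "refl_on (Field omega3_rel) omega3_rel" "trans omega3_rel" "antisym omega3_rel"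
      "total_on (Field omega3_rel) omega3_rel"
    using Well_order_omega3
    unfolding well_order_on_def linear_order_on_def partial_order_on_def preorder_on_def by auto
  fix x y z :: ordinal
  show "(x < y) = (x \<le> y \<and> \<not> y \<le> x)" by (rule less_ordinal_def)
  show "x \<le> x" unfolding less_eq_ordinal_def using L(1) Rep_ordinal refl_onD by fast
  show "x \<le> y \<Longrightarrow> y \<le> z \<Longrightarrow> x \<le> z" unfolding less_eq_ordinal_def using L(2) by (meson transD)
  show "x \<le> y \<Longrightarrow> y \<le> x \<Longrightarrow> x = y"
    unfolding less_eq_ordinal_def using L(3) by (metis antisymD Rep_ordinal_inject)
  show "x \<le> y \<or> y \<le> x"
    unfolding less_eq_ordinal_def
    using L(1,4) Rep_ordinal unfolding total_on_def by (metis refl_onD)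
qed

end

lemma less_ordinal_iff:
  "a < b \<longleftrightarrow> (Rep_ordinal a, Rep_ordinal b) \<in> omega3_rel - Id"
  by (auto simp: less_le less_eq_ordinal_def Rep_ordinal_inject)

instance ordinal :: wellorder
proof
  fix P :: "ordinal \<Rightarrow> bool" and a
  assume step: "\<And>x. (\<And>y. y < x \<Longrightarrow> P y) \<Longrightarrow> P x"
  have "wf (omega3_rel - Id)" using Well_order_omega3 unfolding well_order_on_def by blast
  then have "wf {(x, y :: ordinal). x < y}"
    by (rule wf_subset[OF wf_inv_image[where f = Rep_ordinal]])
      (auto simp: less_ordinal_iff inv_image_def)
  then show "P a" by (induction a rule: wf_induct_rule) (use step in auto)
qed

instantiation ordinal :: conditionally_complete_linorder
begin

definition inf_ordinal :: "ordinal \<Rightarrow> ordinal \<Rightarrow> ordinal" where "inf_ordinal = min"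
definition sup_ordinal :: "ordinal \<Rightarrow> ordinal \<Rightarrow> ordinal" where "sup_ordinal = max"
definition Inf_ordinal :: "ordinal set \<Rightarrow> ordinal" where "Inf (A :: ordinal set) = (LEAST a. a \<in> A)"
definition Sup_ordinal :: "ordinal set \<Rightarrow> ordinal" where "Sup (A :: ordinal set) = (LEAST u. \<forall>a\<in>A. a \<le> u)"

instance
proof
  fix x y z :: ordinal and A :: "ordinal set"
  show "x \<in> A \<Longrightarrow> Inf A \<le> x" unfolding Inf_ordinal_def by (rule Least_le)
  show "A \<noteq> {} \<Longrightarrow> (\<And>x. x \<in> A \<Longrightarrow> z \<le> x) \<Longrightarrow> z \<le> Inf A"
    unfolding Inf_ordinal_def by (metis LeastI ex_in_conv)
  show "x \<le> Sup A" if "x \<in> A" "bdd_above A"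
  proof -
    obtain u where "\<forall>a\<in>A. a \<le> u" using \<open>bdd_above A\<close> unfolding bdd_above_def by blast
    then have "\<forall>a\<in>A. a \<le> Sup A" unfolding Sup_ordinal_def by (rule LeastI)
    with that show ?thesis by blast
  qed
  show "A \<noteq> {} \<Longrightarrow> (\<And>x. x \<in> A \<Longrightarrow> x \<le> z) \<Longrightarrow> Sup A \<le> z"
    unfolding Sup_ordinal_def by (simp add: Least_le)
qed (auto simp: inf_ordinal_def sup_ordinal_def)

end

lemma gt_ex_ordinal: "\<exists>b. a < (b::ordinal)"
proof -
  have inf: "infinite (Field omega3_rel)"
    using Cinfinite_cardSucs(3) unfolding cinfinite_def by blast
  obtain b where "b \<in> Field omega3_rel" "Rep_ordinal a \<noteq> b" "(Rep_ordinal a, b) \<in> omega3_rel"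
    using infinite_Card_order_limit[OF Card_order_cardSucs(3) inf Rep_ordinal] by blast
  then have "a < Abs_ordinal b" by (simp add: less_ordinal_iff Abs_ordinal_inverse)
  then show ?thesis ..
qed

lemma ex_strict_upper_bound:
  fixes A :: "ordinal set"
  assumes "|A| \<le>o cardSuc (cardSuc natLeq)"
  shows "\<exists>c. \<forall>a\<in>A. a < c"
proof (rule ccontr)
  assume *: "\<not> ?thesis"
  let ?K = "Rep_ordinal ` A"
  have "cofinal ?K omega3_rel"
    unfolding cofinal_def
  proof
    fix r assume "r \<in> Field omega3_rel"
    then obtain x where x: "r = Rep_ordinal x" by (rule Rep_ordinal_cases)
    obtain y where "x < y" using gt_ex_ordinal by blast
    moreover obtain a where "a \<in> A" "\<not> a < y" using * by blast
    ultimately have "a \<in> A" "x < a" by auto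
    then show "\<exists>b\<in>?K. r \<noteq> b \<and> (r, b) \<in> omega3_rel"
      using x by (auto simp: less_ordinal_iff)
  qed
  moreover have "?K \<subseteq> Field omega3_rel" using Rep_ordinal by auto
  ultimately have "|?K| =o omega3_rel"
    using regularCard_cardSuc[OF Cinfinite_cardSucs(2)] unfolding regularCard_def by blast
  from ordIso_ordLeq_trans[OF ordIso_symmetric[OF this] card_of_image]
  have "omega3_rel \<le>o |A|" .
  from ordLeq_transitive[OF this assms]
  have "omega3_rel \<le>o cardSuc (cardSuc natLeq)" .
  then show False
    using not_ordLess_ordLeq[OF cardSuc_greater[OF Card_order_cardSucs(2)]] by simp
qed

definition osuc :: "ordinal \<Rightarrow> ordinal" where
  "osuc a = (LEAST b. a < b)"

lemma less_osuc: "a < osuc a"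
  unfolding osuc_def using gt_ex_ordinal by (rule LeastI_ex)

lemma osuc_le_iff: "osuc a \<le> b \<longleftrightarrow> a < b"
  using less_osuc by (metis Least_le osuc_def order_less_le_trans)

lemma less_osuc_iff: "b < osuc a \<longleftrightarrow> b \<le> a"
  using osuc_le_iff by (meson not_le)

lemma Sup_lessThan_osuc: "Sup {..<osuc a} = a"
  unfolding Sup_ordinal_def
  by (rule Least_equality) (auto simp: less_osuc_iff)

instantiation ordinal :: "{zero, one}"
begin
definition zero_ordinal :: ordinal where "(0::ordinal) = (LEAST a. True)"
definition one_ordinal :: ordinal where "(1::ordinal) = osuc 0"
instance ..
end

lemma zero_le_ordinal: "0 \<le> (a::ordinal)"
  unfolding zero_ordinal_def by (simp add: Least_le)

definition is_succ :: "ordinal \<Rightarrow> bool" where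
  "is_succ a \<longleftrightarrow> (\<exists>b. a = osuc b)"

definition is_limit :: "ordinal \<Rightarrow> bool" where
  "is_limit a \<longleftrightarrow> a \<noteq> 0 \<and> \<not> is_succ a"

text \<open>Transfinite recursion: \<open>z\<close> at zero, \<open>s\<close> applied at successors (the predecessor of a successor
  \<open>b\<close> is \<open>Sup {..<b}\<close>), suprema at limits.\<close>

function orec :: "ordinal \<Rightarrow> (ordinal \<Rightarrow> ordinal) \<Rightarrow> ordinal \<Rightarrow> ordinal" where
  "orec z s b =
    (if b = 0 then z
     else if is_succ b then s (orec z s (Sup {..<b}))
     else (SUP c\<in>{..<b}. orec z s c))"
  by pat_completeness auto
termination
proof (relation "inv_image {(x, y). x < y} (\<lambda>(z, s, b). b)")
  show "wf (inv_image {(x, y :: ordinal). x < y} (\<lambda>(z :: ordinal, s :: ordinal \<Rightarrow> ordinal, b). b))"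
    by (intro wf_inv_image wf)
qed (auto simp: is_succ_def Sup_lessThan_osuc less_osuc)

declare orec.simps [simp del]

lemma orec_0: "orec z s 0 = z"
  by (simp add: orec.simps[of z s 0])

lemma orec_osuc: "orec z s (osuc b) = s (orec z s b)"
proof -
  have "osuc b \<noteq> 0" using less_osuc[of b] zero_le_ordinal[of b] by auto
  then show ?thesis
    by (subst orec.simps) (auto simp: is_succ_def Sup_lessThan_osuc)
qed

lemma orec_limit: "is_limit l \<Longrightarrow> orec z s l = (SUP c\<in>{..<l}. orec z s c)"
  by (subst orec.simps) (auto simp: is_limit_def)

instantiation ordinal :: "{plus, times}"
begin
definition plus_ordinal :: "ordinal \<Rightarrow> ordinal \<Rightarrow> ordinal" where "a + (b::ordinal) = orec a osuc b"
definition times_ordinal :: "ordinal \<Rightarrow> ordinal \<Rightarrow> ordinal" where "a * (b::ordinal) = orec 0 (\<lambda>y. y + a) b"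
instance ..
end

lemma osuc_eq_plus_1: "osuc a = a + 1"
  by (simp add: plus_ordinal_def one_ordinal_def orec_osuc orec_0)

text \<open>Correct for nonzero bases only; the base used below is \<open>\<omega>\<close>.\<close>

definition oexp :: "ordinal \<Rightarrow> ordinal \<Rightarrow> ordinal" where
  "oexp a b = orec 1 (\<lambda>y. y * a) b"

definition omega :: ordinal where
  "omega = (LEAST a. infinite {..<a})"

definition Omega :: ordinal where
  "Omega = (LEAST a. uncountable {..<a})"

definition omega2 :: ordinal where
  "omega2 = (LEAST a. |{..<Omega}| <o |{..<a}| )"

lemma cardSucs_less_omega3:
  "cardSuc (cardSuc natLeq) <o omega3_rel" "cardSuc natLeq <o omega3_rel" "natLeq <o omega3_rel"
proof -
  show 2: "cardSuc (cardSuc natLeq) <o omega3_rel"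
    by (rule cardSuc_greater[OF Card_order_cardSucs(2)])
  show 1: "cardSuc natLeq <o omega3_rel"
    by (rule ordLess_transitive[OF cardSuc_greater[OF Card_order_cardSucs(1)] 2])
  show "natLeq <o omega3_rel"
    by (rule ordLess_transitive[OF cardSuc_greater[OF natLeq_Card_order] 1])
qed

lemma ex_segment_card:
  assumes "Card_order r" "r <o omega3_rel"
  shows "\<exists>a::ordinal. |{..<a}| =o r"
proof -
  have "Well_order r" using assms(1) card_order_on_well_order_on by blast
  then obtain c where c: "c \<in> Field omega3_rel"
      and iso: "r =o Restr omega3_rel (underS omega3_rel c)"
    using ordLess_iff_ordIso_Restr[OF Well_order_omega3] assms(2) by blast
  let ?a = "Abs_ordinal c"
  have Rep: "Rep_ordinal ?a = c" using c by (rule Abs_ordinal_inverse)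
  have less: "e < ?a \<longleftrightarrow> Rep_ordinal e \<in> underS omega3_rel c" for e
    by (simp add: less_ordinal_iff Rep underS_def conj_commute)
  have img: "Rep_ordinal ` {..<?a} = underS omega3_rel c"
  proof
    show "Rep_ordinal ` {..<?a} \<subseteq> underS omega3_rel c" using less by blast
    show "underS omega3_rel c \<subseteq> Rep_ordinal ` {..<?a}"
    proof
      fix d assume d: "d \<in> underS omega3_rel c"
      then have "d \<in> Field omega3_rel" by (auto simp: underS_def Field_def)
      then obtain e where "d = Rep_ordinal e" by (rule Rep_ordinal_cases)
      with d less show "d \<in> Rep_ordinal ` {..<?a}" by blast
    qed
  qed
  have "bij_betw Rep_ordinal {..<?a} (underS omega3_rel c)"
    using img by (auto simp: bij_betw_def inj_on_def Rep_ordinal_inject)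
  then have "|{..<?a}| =o |underS omega3_rel c|" by (rule card_of_ordIsoI)
  moreover have "Field (Restr omega3_rel (underS omega3_rel c)) = underS omega3_rel c"
  proof (rule Refl_Field_Restr2)
    show "Refl omega3_rel"
      using Well_order_omega3
      by (simp add: well_order_on_def linear_order_on_def partial_order_on_def preorder_on_def)
    show "underS omega3_rel c \<subseteq> Field omega3_rel" by (auto simp: underS_def Field_def)
  qed
  then have "|Field r| =o |underS omega3_rel c|" using card_of_cong[OF iso] by simp
  ultimately have "|{..<?a}| =o |Field r|"
    by (rule ordIso_transitive[OF _ ordIso_symmetric])
  from ordIso_transitive[OF this card_of_Field_ordIso[OF assms(1)]] show ?thesis ..
qed

lemma infinite_omega: "infinite {..<omega}"
  and finite_below_omega: "a < omega \<Longrightarrow> finite {..<a}"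
proof -
  obtain a :: ordinal where "|{..<a}| =o natLeq"
    using ex_segment_card[OF natLeq_Card_order cardSucs_less_omega3(3)] by blast
  then have "infinite {..<a}"
    unfolding ordIso_iff_ordLeq using infinite_iff_natLeq_ordLeq[of "{..<a}"] by simp
  then show "infinite {..<omega}" unfolding omega_def by (rule LeastI)
  show "finite {..<a}" if "a < omega" for a
    using that not_less_Least unfolding omega_def by blast
qed

lemma card_Omega: "|{..<Omega}| =o cardSuc natLeq"
  and countable_below_Omega: "a < Omega \<Longrightarrow> countable {..<a}"
proof -
  obtain a :: ordinal where a: "|{..<a}| =o cardSuc natLeq"
    using ex_segment_card[OF Card_order_cardSucs(1) cardSucs_less_omega3(2)] by blast
  have unc: "uncountable A \<longleftrightarrow> cardSuc natLeq \<le>o |A|" for A :: "ordinal set"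
    using cardSuc_ordLess_ordLeq[OF natLeq_Card_order card_of_Card_order, of A]
      not_ordLeq_iff_ordLess[OF natLeq_Well_order card_of_Well_order, of A]
      countable_card_le_natLeq[of A]
    by simp
  have "uncountable {..<a}"
    using a unc[of "{..<a}"] unfolding ordIso_iff_ordLeq by simp
  then have "uncountable {..<Omega}" and le: "Omega \<le> a"
    unfolding Omega_def by (rule LeastI, rule Least_le)
  then have "cardSuc natLeq \<le>o |{..<Omega}|" using unc[of "{..<Omega}"] by simp
  moreover have "|{..<Omega}| \<le>o |{..<a}|" using le by (intro card_of_mono1) auto
  ultimately show "|{..<Omega}| =o cardSuc natLeq"
    using ordLeq_ordIso_trans[OF _ a] ordIso_iff_ordLeq[of "|{..<Omega}|"] by blast
  show "countable {..<a}" if "a < Omega" for a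
    using that not_less_Least unfolding Omega_def by blast
qed

lemma card_omega2: "|{..<omega2}| =o cardSuc (cardSuc natLeq)"
  and card_below_omega2: "a < omega2 \<Longrightarrow> |{..<a}| \<le>o |{..<Omega}|"
proof -
  obtain a :: ordinal where a: "|{..<a}| =o cardSuc (cardSuc natLeq)"
    using ex_segment_card[OF Card_order_cardSucs(2) cardSucs_less_omega3(1)] by blast
  have big: "|{..<Omega}| <o |A| \<longleftrightarrow> cardSuc (cardSuc natLeq) \<le>o |A|" for A :: "ordinal set"
    using cardSuc_ordLess_ordLeq[OF Card_order_cardSucs(1) card_of_Card_order]
      ordIso_ordLess_trans[OF card_Omega] ordIso_ordLess_trans[OF ordIso_symmetric[OF card_Omega]]
    by blast
  have "|{..<Omega}| <o |{..<a}|"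
    using a big[of "{..<a}"] unfolding ordIso_iff_ordLeq by simp
  then have "|{..<Omega}| <o |{..<omega2}|" and le: "omega2 \<le> a"
    unfolding omega2_def by (rule LeastI, rule Least_le)
  then have "cardSuc (cardSuc natLeq) \<le>o |{..<omega2}|" using big[of "{..<omega2}"] by simp
  moreover have "|{..<omega2}| \<le>o |{..<a}|" using le by (intro card_of_mono1) auto
  ultimately show "|{..<omega2}| =o cardSuc (cardSuc natLeq)"
    using ordLeq_ordIso_trans[OF _ a] ordIso_iff_ordLeq[of "|{..<omega2}|"] by blast
  show "|{..<a}| \<le>o |{..<Omega}|" if "a < omega2" for a
    using that not_less_Least not_ordLeq_iff_ordLess[OF card_of_Well_order card_of_Well_order]
    unfolding omega2_def by blast
qed

definition cofinality :: "ordinal \<Rightarrow> ordinal" where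
  "cofinality a =
    (LEAST l. \<exists>f. (\<forall>x<l. f x < a) \<and> (\<forall>b<a. \<exists>x<l. b \<le> f x))"

definition second_kind :: "ordinal \<Rightarrow> bool" where
  "second_kind \<eta> \<longleftrightarrow> is_limit \<eta> \<and> \<eta> < omega2 \<and> cofinality \<eta> = omega"

definition third_kind :: "ordinal \<Rightarrow> bool" where
  "third_kind \<eta> \<longleftrightarrow> is_limit \<eta> \<and> \<eta> < omega2 \<and> cofinality \<eta> = Omega"

section \<open>Normal functions of first class\<close>

text \<open>Such functions are represented by total functions, of which only the values on
  \<open>{1..<Omega}\<close> are relevant.\<close>

definition normal_first_class :: "(ordinal \<Rightarrow> ordinal) \<Rightarrow> bool" where
  "normal_first_class \<phi> \<longleftrightarrow>
    \<phi> ` {1..<Omega} \<subseteq> {1..<Omega} \<and>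
    strict_mono_on {1..<Omega} \<phi> \<and>
    (\<forall>x<Omega. is_limit x \<longrightarrow> \<phi> x = (SUP x'\<in>{1..<x}. \<phi> x'))"

definition V :: "(ordinal \<Rightarrow> ordinal) \<Rightarrow> ordinal set" where
  "V \<phi> = \<phi> ` {1..<Omega}"

definition is_derivative :: "(ordinal \<Rightarrow> ordinal) \<Rightarrow> (ordinal \<Rightarrow> ordinal) \<Rightarrow> bool" where
  "is_derivative \<psi> \<phi> \<longleftrightarrow>
    normal_first_class \<psi> \<and> V \<psi> = {x \<in> {1..<Omega}. \<phi> x = x}"

text \<open>The relation \<open>\<alpha> \<rightarrow> \<beta>\<close> for the family \<open>\<phi>\<close>. For \<open>\<alpha> = \<beta>\<close> it holds vacuously,
  so that \<open>arrow \<phi> (\<xi> + 1) \<xi>'\<close> imposes nothing when \<open>\<xi>' = \<xi> + 1\<close>.\<close>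

definition arrow :: "(ordinal \<Rightarrow> ordinal \<Rightarrow> ordinal) \<Rightarrow> ordinal \<Rightarrow> ordinal \<Rightarrow> bool" where
  "arrow \<phi> \<alpha> \<beta> \<longleftrightarrow> (\<forall>\<zeta>. \<alpha> < \<zeta> \<and> \<zeta> \<le> \<beta> \<longrightarrow> V (\<phi> \<zeta>) \<subseteq> V (\<phi> \<alpha>))"

end

theory Submission
  imports Defs
begin

text \<open>Let \<open>\<eta>\<close> be the supremum of the given sequence. If \<open>\<eta> = \<Lambda>\<close>, property (4) applies. Otherwise
  \<open>\<eta>\<close> is of the third kind. Each \<open>\<eta>'\<^sub>x\<close> above \<open>\<eta>\<^sub>y\<close> either equals some \<open>\<eta>\<^sub>z\<close> with \<open>z > y\<close>, or lies in
  an interval \<open>(\<eta>\<^sub>z, \<eta>\<^bsub>z+1\<^esub>]\<close> with \<open>z \<ge> y\<close>; in the latter case (2b) gives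
  \<open>V \<phi>\<^bsub>\<eta>'\<^sub>x\<^esub> \<subseteq> V \<phi>\<^bsub>\<eta>\<^sub>z+1\<^esub> \<subseteq> V \<phi>\<^bsub>\<eta>\<^sub>z\<^esub>\<close>. So all elements of \<open>V \<phi>\<^bsub>\<eta>'\<^sub>x\<^esub>\<close> are at least
  \<open>\<phi>\<^bsub>\<eta>\<^sub>z\<^esub>(1) = \<phi>\<^sub>\<eta>(z) \<ge> z \<ge> y\<close>, and \<open>y < \<Omega>\<close> was arbitrary.\<close>

section \<open>Successors, limits and the regularity of \<open>Omega\<close>\<close>

lemma zero_less_ordinal_iff: "0 < (a::ordinal) \<longleftrightarrow> a \<noteq> 0"
  using zero_le_ordinal[of a] by auto

lemma one_le_ordinal_iff: "1 \<le> (a::ordinal) \<longleftrightarrow> a \<noteq> 0"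
  unfolding one_ordinal_def osuc_le_iff by (rule zero_less_ordinal_iff)

lemma is_limit_osuc_less:
  assumes "is_limit l" "a < l"
  shows "osuc a < l"
  using assms unfolding is_limit_def is_succ_def by (metis le_less osuc_le_iff)

lemma lessThan_osuc: "{..<osuc a} = insert a {..<a}"
  by (auto simp: less_osuc_iff)

lemma uncountable_Omega: "uncountable {..<Omega}"
  using ordLess_ordIso_trans[OF cardSuc_greater[OF natLeq_Card_order] ordIso_symmetric[OF card_Omega]]
    countable_card_le_natLeq not_ordLess_ordLeq by blast

lemma is_limit_Omega: "is_limit Omega"
  unfolding is_limit_def is_succ_def
proof safe
  assume "Omega = 0"
  then have "{..<Omega} = {}" using zero_le_ordinal by (auto simp: leD)
  then show False using uncountable_Omega by simp
next
  fix b assume "Omega = osuc b"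
  moreover from this have "countable {..<b}"
    using countable_below_Omega[of b] less_osuc[of b] by simp
  ultimately show False using uncountable_Omega by (metis countable_insert lessThan_osuc)
qed

text \<open>Regularity of \<open>Omega\<close>: an unbounded countable \<open>A\<close> would cover
  \<open>{..<Omega}\<close> by countably many countable initial segments.\<close>

lemma countable_bounded_below_Omega:
  assumes "countable A" "A \<subseteq> {..<Omega}"
  shows "\<exists>b<Omega. \<forall>a\<in>A. a < b"
proof (rule ccontr)
  assume *: "\<not> ?thesis"
  have "{..<Omega} \<subseteq> (\<Union>a\<in>A. {..<osuc a})"
    using * by (fastforce simp: less_osuc_iff not_less)
  moreover have "countable (\<Union>a\<in>A. {..<osuc a})"
    using assms is_limit_osuc_less[OF is_limit_Omega] countable_below_Omega
    by (intro countable_UN) auto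
  ultimately show False using uncountable_Omega countable_subset by blast
qed

text \<open>\<open>SUP\<close> on \<open>ordinal\<close> behaves as a supremum only for bounded
  sets. A set of at most aleph_1 values is bounded because the type has order type omega_3, which is
  regular.\<close>

lemma bdd_above_image_lessThan_Omega:
  fixes f :: "ordinal \<Rightarrow> ordinal"
  assumes "a \<le> Omega"
  shows "bdd_above (f ` {..<a})"
proof -
  have "|f ` {..<a}| \<le>o |{..<Omega}|"
    using assms by (intro ordLeq_transitive[OF card_of_image] card_of_mono1) auto
  then have "|f ` {..<a}| \<le>o cardSuc (cardSuc natLeq)"
    using ordLeq_ordIso_trans[OF _ card_Omega] ordLeq_transitive
      ordLess_imp_ordLeq[OF cardSuc_greater[OF Card_order_cardSucs(1)]] by blast
  then show ?thesis
    using ex_strict_upper_bound unfolding bdd_above_def by (meson less_imp_le)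
qed

section \<open>Cofinality of limit ordinals below \<open>omega2\<close>\<close>

lemma cofinality_le:
  assumes "\<And>x. x < l \<Longrightarrow> f x < a" "\<And>b. b < a \<Longrightarrow> \<exists>x<l. b \<le> f x"
  shows "cofinality a \<le> l"
  unfolding cofinality_def using assms by (intro Least_le) blast

lemma cofinality_witness:
  obtains f where "\<And>x. x < cofinality a \<Longrightarrow> f x < a"
    "\<And>b. b < a \<Longrightarrow> \<exists>x<cofinality a. b \<le> f x"
proof -
  \<comment> \<open>The identity is a cofinal map of length \<open>a\<close>, so the least length in
    the definition is attained.\<close>
  have "\<exists>f. (\<forall>x<cofinality a. f x < a) \<and> (\<forall>b<a. \<exists>x<cofinality a. b \<le> f x)"
    unfolding cofinality_def by (rule LeastI[of _ a]) (auto intro!: exI[of _ id])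
  with that show thesis by blast
qed

text \<open>Cofinality is measured by arbitrary cofinal maps, so a surjection from
  \<open>{..<l}\<close> onto a cofinal set is enough; only cardinality matters.\<close>

lemma cofinality_le_of_cofinal_set:
  assumes "C \<subseteq> {..<a}" "\<And>b. b < a \<Longrightarrow> \<exists>c\<in>C. b \<le> c" "a \<noteq> 0" "|C| \<le>o |{..<l}|"
  shows "cofinality a \<le> l"
proof -
  have "C \<noteq> {}" using assms(2)[of 0] assms(3) by (auto simp: zero_less_ordinal_iff)
  then obtain f where f: "f ` {..<l} = C" using card_of_ordLeq2[of C "{..<l}"] assms(4) by blast
  show ?thesis
  proof (rule cofinality_le[of l f])
    show "f x < a" if "x < l" for x using f assms(1) that by blast
    show "\<exists>x<l. b \<le> f x" if "b < a" for b using f assms(2)[OF that] by blast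
  qed
qed

lemma cofinality_le_Omega:
  assumes "a \<noteq> 0" "a < omega2"
  shows "cofinality a \<le> Omega"
  using assms card_below_omega2 by (intro cofinality_le_of_cofinal_set[of "{..<a}"]) auto

text \<open>A finite set of values below a limit has a maximum, and the successor of that maximum is
  still below the limit.\<close>

lemma omega_le_cofinality:
  assumes "is_limit a"
  shows "omega \<le> cofinality a"
proof (rule ccontr)
  assume "\<not> ?thesis"
  then have fin: "finite {..<cofinality a}" using finite_below_omega by simp
  obtain f where f: "\<And>x. x < cofinality a \<Longrightarrow> f x < a"
    "\<And>b. b < a \<Longrightarrow> \<exists>x<cofinality a. b \<le> f x" by (rule cofinality_witness) blast
  have ne: "f ` {..<cofinality a} \<noteq> {}"
    using f(2)[of 0] assms by (auto simp: is_limit_def zero_less_ordinal_iff)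
  let ?m = "Max (f ` {..<cofinality a})"
  have "?m \<in> f ` {..<cofinality a}" using fin ne by (intro Max_in) auto
  then have "?m < a" using f(1) by force
  then obtain x where "x < cofinality a" "osuc ?m \<le> f x"
    using f(2) is_limit_osuc_less[OF assms] by blast
  then have "?m < f x" "f x \<le> ?m" using fin by (auto simp: osuc_le_iff)
  then show False by simp
qed

text \<open>A countable cofinal set can be enumerated again in length \<open>omega\<close>.\<close>

lemma cofinality_less_Omega:
  assumes "is_limit a" "cofinality a < Omega"
  shows "cofinality a = omega"
proof (rule antisym[OF _ omega_le_cofinality[OF assms(1)]])
  obtain f where f: "\<And>x. x < cofinality a \<Longrightarrow> f x < a"
    "\<And>b. b < a \<Longrightarrow> \<exists>x<cofinality a. b \<le> f x" by (rule cofinality_witness) blast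
  let ?C = "f ` {..<cofinality a}"
  have "|?C| \<le>o natLeq"
    using countable_below_Omega[OF assms(2)] countable_card_le_natLeq by blast
  moreover have "natLeq \<le>o |{..<omega}|"
    using infinite_omega infinite_iff_natLeq_ordLeq by blast
  ultimately have "|?C| \<le>o |{..<omega}|" by (rule ordLeq_transitive)
  then show "cofinality a \<le> omega"
    using f assms(1) by (intro cofinality_le_of_cofinal_set[of ?C]) (auto simp: is_limit_def)
qed

lemma limit_second_or_third_kind:
  assumes "is_limit a" "a < omega2"
  shows "second_kind a \<or> third_kind a"
  using assms cofinality_le_Omega[of a] cofinality_less_Omega[of a]
  unfolding second_kind_def third_kind_def is_limit_def by fastforce

section \<open>Suprema of strictly increasing sequences of length \<open>Omega\<close>\<close>

lemma
  assumes mono: "strict_mono_on {..<Omega} f"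
  shows less_SUP_strict_mono_Omega: "x < Omega \<Longrightarrow> f x < (SUP x\<in>{..<Omega}. f x)"
    and less_SUP_strict_mono_OmegaD: "b < (SUP x\<in>{..<Omega}. f x) \<Longrightarrow> \<exists>x<Omega. b < f x"
    and is_limit_SUP_strict_mono_Omega: "is_limit (SUP x\<in>{..<Omega}. f x)"
proof -
  let ?S = "SUP x\<in>{..<Omega}. f x"
  have bdd: "bdd_above (f ` {..<Omega})" by (rule bdd_above_image_lessThan_Omega) simp
  have ne: "0 < Omega" using is_limit_Omega by (simp add: is_limit_def zero_less_ordinal_iff)
  show less: "f x < ?S" if "x < Omega" for x
  proof -
    have x: "osuc x < Omega" using is_limit_osuc_less[OF is_limit_Omega that] .
    then have "f x < f (osuc x)" using mono that less_osuc by (auto simp: strict_mono_on_def)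
    also have "\<dots> \<le> ?S" using x bdd by (intro cSUP_upper) auto
    finally show ?thesis .
  qed
  show lessD: "\<exists>x<Omega. b < f x" if "b < ?S" for b
    using that ne less_cSUP_iff[OF _ bdd, of b] by auto
  show "is_limit ?S"
    unfolding is_limit_def is_succ_def
  proof safe
    assume "?S = 0"
    then show False using less[OF ne] zero_le_ordinal by (simp add: leD)
  next
    fix b assume S: "?S = osuc b"
    then obtain x where "x < Omega" "b < f x" using lessD less_osuc by metis
    then show False using less[of x] S by (simp add: less_osuc_iff)
  qed
qed

text \<open>A cofinal map \<open>g\<close> of countable length would pull back along
  \<open>f\<close> to countably many indices \<open>h y\<close>. These have a bound \<open>b\<close>
  below \<open>Omega\<close>, and then \<open>f b\<close> exceeds every \<open>g y\<close>.\<close>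

lemma third_kind_SUP_strict_mono_Omega:
  assumes mono: "strict_mono_on {..<Omega} f" and less: "(SUP x\<in>{..<Omega}. f x) < omega2"
  shows "third_kind (SUP x\<in>{..<Omega}. f x)"
proof -
  let ?S = "SUP x\<in>{..<Omega}. f x"
  have lim: "is_limit ?S" using is_limit_SUP_strict_mono_Omega[OF mono] .
  have "\<not> cofinality ?S < Omega"
  proof
    assume "cofinality ?S < Omega"
    then have count: "countable {..<cofinality ?S}" by (rule countable_below_Omega)
    obtain g where g: "\<And>y. y < cofinality ?S \<Longrightarrow> g y < ?S"
      "\<And>b. b < ?S \<Longrightarrow> \<exists>y<cofinality ?S. b \<le> g y" by (rule cofinality_witness) blast
    have "\<forall>y\<in>{..<cofinality ?S}. \<exists>x<Omega. g y < f x"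
      using g(1) less_SUP_strict_mono_OmegaD[OF mono] by simp
    then obtain h where h: "\<And>y. y < cofinality ?S \<Longrightarrow> h y < Omega \<and> g y < f (h y)"
      by (metis lessThan_iff)
    obtain b where b: "b < Omega" "\<And>y. y < cofinality ?S \<Longrightarrow> h y < b"
      using countable_bounded_below_Omega[of "h ` {..<cofinality ?S}"] count h by auto
    obtain y where y: "y < cofinality ?S" "f b \<le> g y"
      using g(2) less_SUP_strict_mono_Omega[OF mono b(1)] by blast
    have "f (h y) < f b" using mono h b y(1) by (simp add: strict_mono_on_def)
    then show False using h[OF y(1)] y(2) by (meson leD le_less_trans less_trans)
  qed
  then show ?thesis
    using lim less cofinality_le_Omega[of ?S] by (auto simp: third_kind_def is_limit_def)
qed

section \<open>Lower bounds for values and ranges of normal functions\<close>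

lemma normal_first_class_ge:
  assumes "normal_first_class \<phi>" "1 \<le> x" "x < Omega"
  shows "x \<le> \<phi> x"
  using assms(2,3)
proof (induction x rule: less_induct)
  case (less x)
  show ?case
  proof (rule ccontr)
    assume "\<not> x \<le> \<phi> x"
    then have lt: "\<phi> x < x" by simp
    \<comment> \<open>The value \<open>\<phi> x\<close> is itself a smaller argument; strict
      monotonicity makes it a counterexample, against the induction hypothesis.\<close>
    have mem: "\<phi> x \<in> {1..<Omega}"
      using assms(1) less.prems unfolding normal_first_class_def by fastforce
    then have "\<phi> (\<phi> x) < \<phi> x"
      using assms(1) less.prems lt
      unfolding normal_first_class_def strict_mono_on_def by auto
    moreover have "\<phi> x \<le> \<phi> (\<phi> x)" using less.IH[OF lt] mem by auto
    ultimately show False by simp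
  qed
qed

lemma normal_first_class_V_ge:
  assumes "normal_first_class \<phi>" "v \<in> V \<phi>"
  shows "\<phi> 1 \<le> v"
proof -
  obtain x where x: "1 \<le> x" "x < Omega" "v = \<phi> x" using assms(2) by (auto simp: V_def)
  then have "1 < Omega" by simp
  then have "x = 1 \<or> \<phi> 1 < \<phi> x"
    using assms(1) x unfolding normal_first_class_def strict_mono_on_def by (cases "x = 1") auto
  with x show ?thesis by auto
qed

lemma is_derivative_V_subset: "is_derivative \<psi> \<phi> \<Longrightarrow> V \<psi> \<subseteq> V \<phi>"
  unfolding is_derivative_def V_def by (auto intro: rev_image_eqI)

theorem theorem1:
  fixes \<Lambda> :: ordinal
    and \<phi> :: "ordinal \<Rightarrow> ordinal \<Rightarrow> ordinal"
    and \<tau> :: "ordinal \<Rightarrow> ordinal"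
    and s :: "ordinal \<Rightarrow> ordinal \<Rightarrow> ordinal"
    and \<eta>' :: "ordinal \<Rightarrow> ordinal"
  assumes "is_limit \<Lambda>" and "\<Lambda> \<le> omega2"
    and normal: "\<And>\<eta>. \<eta> < \<Lambda> \<Longrightarrow> normal_first_class (\<phi> \<eta>)"
    and prop_1a: "\<And>x. 1 \<le> x \<Longrightarrow> x < Omega \<Longrightarrow> \<phi> 0 x = oexp omega x"
    and prop_1b: "\<And>\<eta>. \<eta> + 1 < \<Lambda> \<Longrightarrow> is_derivative (\<phi> (\<eta> + 1)) (\<phi> \<eta>)"
    and prop_1c: "\<And>\<eta>. \<eta> < \<Lambda> \<Longrightarrow> second_kind \<eta> \<Longrightarrow>
      is_limit (\<tau> \<eta>) \<and> \<tau> \<eta> < Omega \<and>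
      strict_mono_on {..<\<tau> \<eta>} (s \<eta>) \<and> (SUP x\<in>{..<\<tau> \<eta>}. s \<eta> x) = \<eta> \<and>
      V (\<phi> \<eta>) = (\<Inter>x\<in>{..<\<tau> \<eta>}. V (\<phi> (s \<eta> x)))"
    and prop_1d: "\<And>\<eta>. \<eta> < \<Lambda> \<Longrightarrow> third_kind \<eta> \<Longrightarrow>
      \<tau> \<eta> = Omega \<and>
      strict_mono_on {..<Omega} (s \<eta>) \<and> (SUP x\<in>{..<Omega}. s \<eta> x) = \<eta> \<and>
      (\<forall>x. 1 \<le> x \<and> x < Omega \<longrightarrow> \<phi> \<eta> x = \<phi> (s \<eta> x) 1)"
    and prop_2a: "\<And>\<eta> x. \<eta> < \<Lambda> \<Longrightarrow> is_limit \<eta> \<Longrightarrow> 1 \<le> x \<Longrightarrow> x < \<tau> \<eta> \<Longrightarrow> is_limit x \<Longrightarrow>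
      is_limit (s \<eta> x) \<and> \<tau> (s \<eta> x) = x \<and> (\<forall>x'<x. s (s \<eta> x) x' = s \<eta> x')"
    and prop_2b: "\<And>\<eta> x. \<eta> < \<Lambda> \<Longrightarrow> is_limit \<eta> \<Longrightarrow> 1 \<le> x \<Longrightarrow> x < \<tau> \<eta> \<Longrightarrow>
      arrow \<phi> (s \<eta> x + 1) (s \<eta> (x + 1))"
    and prop_3: "\<And>\<eta>. \<eta> < \<Lambda> \<Longrightarrow> second_kind \<eta> \<Longrightarrow> \<phi> \<eta> 1 = \<tau> \<eta> \<Longrightarrow>
      \<exists>\<theta>. third_kind \<theta> \<and> \<eta> < \<theta> \<and> \<theta> < \<Lambda> \<and>
        (\<forall>x<\<tau> \<eta>. s \<theta> x = s \<eta> x) \<and> s \<theta> (\<tau> \<eta>) = \<eta>"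
    and prop_4: "\<And>l \<mu>. is_limit l \<Longrightarrow> (\<And>\<nu>. \<nu> < l \<Longrightarrow> \<mu> \<nu> < \<Lambda>) \<Longrightarrow>
      (SUP \<nu>\<in>{..<l}. \<mu> \<nu>) = \<Lambda> \<Longrightarrow> (\<Inter>\<nu>\<in>{..<l}. V (\<phi> (\<mu> \<nu>))) = {}"
    and "strict_mono_on {..<Omega} \<eta>'" and "\<And>x. x < Omega \<Longrightarrow> \<eta>' x < \<Lambda>"
  shows "(\<Inter>x\<in>{..<Omega}. V (\<phi> (\<eta>' x))) = {}"
proof (rule ccontr)
  assume "(\<Inter>x\<in>{..<Omega}. V (\<phi> (\<eta>' x))) \<noteq> {}"
  then obtain v where v: "\<And>x. x < Omega \<Longrightarrow> v \<in> V (\<phi> (\<eta>' x))" by blast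
  define \<eta> where "\<eta> = (SUP x\<in>{..<Omega}. \<eta>' x)"
  note mono' = \<open>strict_mono_on {..<Omega} \<eta>'\<close>
  have Omega_pos: "0 < Omega"
    using is_limit_Omega by (simp add: is_limit_def zero_less_ordinal_iff)
  have "\<eta> \<noteq> \<Lambda>"
    using prop_4[OF is_limit_Omega, of \<eta>'] assms(13) v unfolding \<eta>_def by blast
  moreover have "\<eta> \<le> \<Lambda>"
    unfolding \<eta>_def using assms(13) Omega_pos by (intro cSUP_least) (auto intro: less_imp_le)
  ultimately have \<eta>: "\<eta> < \<Lambda>" by simp
  have third: "third_kind \<eta>"
    using third_kind_SUP_strict_mono_Omega[OF mono'] \<eta> assms(2) unfolding \<eta>_def by simp
  then have lim: "is_limit \<eta>" by (simp add: third_kind_def)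
  have \<tau>: "\<tau> \<eta> = Omega" and mono: "strict_mono_on {..<Omega} (s \<eta>)"
    and sup: "(SUP x\<in>{..<Omega}. s \<eta> x) = \<eta>"
    and diag: "\<And>x. 1 \<le> x \<Longrightarrow> x < Omega \<Longrightarrow> \<phi> \<eta> x = \<phi> (s \<eta> x) 1"
    using prop_1d[OF \<eta> third] by auto
  have s_less: "s \<eta> x < \<eta>" if "x < Omega" for x
    using less_SUP_strict_mono_Omega[OF mono that] sup by simp
  have V_ge: "z \<le> w" if "1 \<le> z" "z < Omega" "w \<in> V (\<phi> (s \<eta> z))" for z w
  proof -
    have "z \<le> \<phi> (s \<eta> z) 1" using normal_first_class_ge[OF normal[OF \<eta>]] diag that by metis
    also have "\<dots> \<le> w"
      using normal_first_class_V_ge normal s_less[OF that(2)] \<eta> that(3) by fastforce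
    finally show ?thesis .
  qed

  have "v < Omega"
    using v[OF Omega_pos] normal[OF assms(13)[OF Omega_pos]]
    unfolding V_def normal_first_class_def by fastforce
  \<comment> \<open>By \<open>V_ge\<close>, \<open>v\<close> cannot lie in
    \<open>V (\<phi> (s \<eta> z))\<close> for any \<open>z \<ge> y\<close> below
    \<open>Omega\<close>. A successor also satisfies \<open>1 \<le> y\<close>, the lower end of the
    range where (1d) and (2) speak.\<close>
  define y where "y = osuc v"
  have y: "y < Omega" "v < y" "1 \<le> y"
    using is_limit_osuc_less[OF is_limit_Omega \<open>v < Omega\<close>] less_osuc[of v] zero_le_ordinal[of v]
    unfolding y_def one_le_ordinal_iff by auto
  obtain x where x: "x < Omega" "s \<eta> y < \<eta>' x"
    using less_SUP_strict_mono_OmegaD[OF mono'] s_less[OF y(1)] unfolding \<eta>_def by blast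
  have "\<exists>z<Omega. \<eta>' x \<le> s \<eta> z"
    using less_SUP_strict_mono_OmegaD[OF mono, of "\<eta>' x"] less_SUP_strict_mono_Omega[OF mono' x(1)]
      sup less_imp_le unfolding \<eta>_def by metis
  \<comment> \<open>Taking the least such \<open>z\<close> locates \<open>\<eta>' x\<close> in the
    sequence: all earlier terms lie strictly below it.\<close>
  then obtain z where z: "z < Omega" "\<eta>' x \<le> s \<eta> z"
    and z_least: "\<And>z'. z' < z \<Longrightarrow> \<not> (z' < Omega \<and> \<eta>' x \<le> s \<eta> z')"
    using exists_least_iff[of "\<lambda>z. z < Omega \<and> \<eta>' x \<le> s \<eta> z"] by blast
  have below: "s \<eta> z' < \<eta>' x" if "z' < z" for z'
    using z_least[OF that] that z(1) by auto
  have "y < z"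
  proof (rule ccontr)
    assume "\<not> y < z"
    then have "s \<eta> z \<le> s \<eta> y"
      using mono z(1) y(1) unfolding strict_mono_on_def by (cases "z = y") (auto simp: less_imp_le)
    with x z show False by simp
  qed
  then have z1: "1 \<le> z" using y by simp
  show False
  proof (cases "is_limit z")
    case True
    \<comment> \<open>Property (2a) makes \<open>s \<eta>\<close> continuous at the limit
      \<open>z\<close>, once \<open>s \<eta> z\<close> is known to be of the second kind. Leastness
      of \<open>z\<close> then forces \<open>\<eta>' x = s \<eta> z\<close>.\<close>
    have sz: "is_limit (s \<eta> z)" "\<tau> (s \<eta> z) = z" "\<And>z'. z' < z \<Longrightarrow> s (s \<eta> z) z' = s \<eta> z'"
      using prop_2a[OF \<eta> lim z1 _ True] z \<tau> by auto
    have sz_less: "s \<eta> z < \<Lambda>" using s_less[OF z(1)] \<eta> by simp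
    \<comment> \<open>The third kind would give \<open>\<tau> (s \<eta> z) = Omega\<close>, but this
      length is \<open>z < Omega\<close>.\<close>
    have "\<not> third_kind (s \<eta> z)" using prop_1d[OF sz_less] sz(2) z(1) by auto
    then have "second_kind (s \<eta> z)"
      using limit_second_or_third_kind sz(1) sz_less assms(2) by fastforce
    then have "(SUP z'\<in>{..<z}. s (s \<eta> z) z') = s \<eta> z"
      using prop_1c[OF sz_less] sz(2) by simp
    then have "(SUP z'\<in>{..<z}. s \<eta> z') = s \<eta> z" using sz(3) by simp
    moreover have "(SUP z'\<in>{..<z}. s \<eta> z') \<le> \<eta>' x"
      using \<open>y < z\<close> below by (intro cSUP_least) (auto intro: less_imp_le)
    ultimately have "\<eta>' x = s \<eta> z" using z(2) by simp
    then have "z \<le> v" using V_ge[OF z1 z(1)] v[OF x(1)] by simp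
    then show False using \<open>y < z\<close> \<open>v < y\<close> by simp
  next
    case False
    then obtain u where u: "z = osuc u"
      using z1 by (auto simp: is_limit_def is_succ_def one_le_ordinal_iff)
    have "y \<le> u" "u < z" using u \<open>y < z\<close> less_osuc by (auto simp: less_osuc_iff)
    then have u1: "1 \<le> u" "u < Omega" using y z by auto
    have su: "s \<eta> u + 1 < \<Lambda>"
      using is_limit_osuc_less[OF assms(1)] s_less[OF u1(2)] \<eta> by (simp add: osuc_eq_plus_1)
    have "s \<eta> u + 1 \<le> \<eta>' x" "\<eta>' x \<le> s \<eta> (u + 1)"
      using below[OF \<open>u < z\<close>] z(2) u by (simp_all flip: osuc_eq_plus_1 add: osuc_le_iff)
    \<comment> \<open>\<open>arrow\<close> speaks only of indices strictly above
      \<open>s \<eta> u + 1\<close>, so equality is a separate, trivial case.\<close>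
    then have "V (\<phi> (\<eta>' x)) \<subseteq> V (\<phi> (s \<eta> u + 1))"
      using prop_2b[OF \<eta> lim u1(1)] u1(2) \<tau> unfolding arrow_def by (cases "\<eta>' x = s \<eta> u + 1") auto
    \<comment> \<open>By (1b) the range of the derivative consists of fixed points of
      \<open>\<phi> (s \<eta> u)\<close>, and a fixed point is its own image.\<close>
    also have "\<dots> \<subseteq> V (\<phi> (s \<eta> u))" using is_derivative_V_subset[OF prop_1b[OF su]] .
    finally have "u \<le> v" using V_ge[OF u1] v[OF x(1)] by blast
    then show False using \<open>y \<le> u\<close> \<open>v < y\<close> by simp
  qed
qed

end
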